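(* Let $\mathcal{G}=(\mathcal{V},\mathcal{E})$ be a finite undirected graph without loops, with $\mathcal{V}=\mathcal{B}\cup\mathcal{I}$ partitioned into boundary nodes $\mathcal{B}$ and interior nodes $\mathcal{I}$. Let $\sigma:\mathcal{E}\to(0,\infty)$, let $N\ge 1$, let $f^{(j)}:\mathcal{B}\to\mathbb{R}$ for $j=1,\ldots,N$, and let $u^{(j)}:\mathcal{V}\to\mathbb{R}$ satisfy the Dirichlet problem $[\nabla^T(\sigma\odot\nabla u^{(j)})]_{\mathcal{I}}=0$, $u^{(j)}_{\mathcal{B}}=f^{(j)}$. Define $s^{(j)}:\mathcal{E}\to\{-1,1\}$ by $s^{(j)}=1-2\,\mathbb{1}_{\operatorname{supp}\nabla u^{(j)}}$. Assume: (i) $\bigcup_{j=1}^N\operatorname{supp}\nabla u^{(j)}=\mathcal{E}$; (ii) the matrix $[L_\sigma]_{\mathcal{I}\mathcal{I}}$ is invertible; (iii) the matrices $[L_{s^{(j)}\odot\sigma}]_{\mathcal{I}\mathcal{I}}$ are invertible for $j=1,\ldots,N$. Then the linearization at $(\sigma,u^{(1)},\ldots,u^{(N)})$ of the problem of finding $\sigma$ and the $u^{(j)}$ from the power data $\sigma\odot|\nabla u^{(j)}|^2$, $j=1,\ldots,N$, is injective. That is, if $\delta\sigma\in\mathbb{R}^{\mathcal{E}}$ and $\delta u^{(j)}\in\mathbb{R}^{\mathcal{V}}$, $j=1,\ldots,N$, satisfy, for all $j=1,\ldots,N$, $$|\nabla u^{(j)}|^2\odot\delta\sigma+2\,\sigma\odot(\nabla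 u^{(j)})\odot(\nabla\delta u^{(j)})=0,$$ $$(\delta u^{(j)})_{\mathcal{B}}=0,$$ $$[\nabla^T((\nabla u^{(j)})\odot\delta\sigma)]_{\mathcal{I}}+[L_\sigma\delta u^{(j)}]_{\mathcal{I}}=0,$$ then $\delta\sigma=0$ and $\delta u^{(j)}=0$ for all $j=1,\ldots,N$.
   Context: For each edge $i\sim j$ an ordering of its two endpoints is fixed once and for all. The discrete gradient $\nabla:\mathbb{R}^{\mathcal{V}}\to\mathbb{R}^{\mathcal{E}}$ is the linear map $(\nabla u)(i\sim j)=u(i)-u(j)$, and $\nabla^T$ is its transpose. $\odot$ is the componentwise (Hadamard) product; absolute values and squares of vectors are taken componentwise. For any $\tau:\mathcal{E}\to\mathbb{R}$ (of any sign), the discrete Laplacian is $L_\tau u=\nabla^T(\tau\odot\nabla u)$, viewed as a symmetric $|\mathcal{V}|\times|\mathcal{V}|$ matrix. A subscript $\mathcal{I}$ or $\mathcal{B}$ on a vector denotes restriction to that set of nodes; for a matrix, $[M]_{\mathcal{I}\mathcal{I}}$ is the submatrix with rows and columns indexed by $\mathcal{I}$. $\operatorname{supp}g=\{x: g(x)\ne 0\}$, and $\mathbb{1}_{X}$ is the indicator function of the set $X$. *)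

theory Defs
  imports Complex_Main "HOL-Library.Indicator_Function"
begin

(* Edges are two-element sets of nodes; ends fixes, for each edge, an ordering of its endpoints.
   Vectors on a finite index set X are represented by functions, of which only the values on X
   are relevant. *)
locale oriented_graph =
  fixes V :: "'v set" and E :: "'v set set" and ends :: "'v set \<Rightarrow> 'v \<times> 'v"
  assumes finite_nodes: "finite V"
    and edges: "\<And>e. e \<in> E \<Longrightarrow> e \<subseteq> V \<and> card e = 2"
    and ends: "\<And>e. e \<in> E \<Longrightarrow> {fst (ends e), snd (ends e)} = e"

definition hadamard :: "('e \<Rightarrow> real) \<Rightarrow> ('e \<Rightarrow> real) \<Rightarrow> 'e \<Rightarrow> real" (infixl "\<odot>" 70) where
  "a \<odot> b = (\<lambda>e. a e * b e)"

definition supp :: "'e set \<Rightarrow> ('e \<Rightarrow> real) \<Rightarrow> 'e set" where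
  "supp X g = {x \<in> X. g x \<noteq> 0}"

definition grad :: "('v set \<Rightarrow> 'v \<times> 'v) \<Rightarrow> ('v \<Rightarrow> real) \<Rightarrow> 'v set \<Rightarrow> real" where
  "grad ends u = (\<lambda>e. u (fst (ends e)) - u (snd (ends e)))"

(* grad ends (indicator {i}) e is the (e, i) entry of the matrix of grad in the standard bases. *)
definition gradT ::
    "'v set set \<Rightarrow> ('v set \<Rightarrow> 'v \<times> 'v) \<Rightarrow> ('v set \<Rightarrow> real) \<Rightarrow> 'v \<Rightarrow> real" where
  "gradT E ends w = (\<lambda>i. \<Sum>e\<in>E. grad ends (indicator {i}) e * w e)"

definition laplacian ::
    "'v set set \<Rightarrow> ('v set \<Rightarrow> 'v \<times> 'v) \<Rightarrow> ('v set \<Rightarrow> real) \<Rightarrow> ('v \<Rightarrow> real) \<Rightarrow> 'v \<Rightarrow> real" where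
  "laplacian E ends \<tau> u = gradT E ends (\<tau> \<odot> grad ends u)"

definition laplacian_mat ::
    "'v set set \<Rightarrow> ('v set \<Rightarrow> 'v \<times> 'v) \<Rightarrow> ('v set \<Rightarrow> real) \<Rightarrow> 'v \<Rightarrow> 'v \<Rightarrow> real" where
  "laplacian_mat E ends \<tau> i j = laplacian E ends \<tau> (indicator {j}) i"

(* Invertibility of the square submatrix of M with rows and columns indexed by the finite set X. *)
definition invertible_on :: "'v set \<Rightarrow> ('v \<Rightarrow> 'v \<Rightarrow> real) \<Rightarrow> bool" where
  "invertible_on X M \<longleftrightarrow> (\<exists>R.
     (\<forall>i\<in>X. \<forall>j\<in>X. (\<Sum>k\<in>X. M i k * R k j) = (if i = j then 1 else 0)) \<and>
     (\<forall>i\<in>X. \<forall>j\<in>X. (\<Sum>k\<in>X. R i k * M k j) = (if i = j then 1 else 0)))"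

end

theory Submission
  imports Defs
begin

text \<open>
  The idea is to eliminate \<open>\<delta>\<sigma>\<close>. On an edge where \<open>\<nabla>u\<close> does not vanish, one factor \<open>\<nabla>u\<close>
  cancels from the linearized power equation, which becomes
  \<open>\<nabla>u \<delta>\<sigma> = - 2 \<sigma> \<nabla>\<delta>u\<close>; hence the linearized current \<open>\<nabla>u \<delta>\<sigma> + \<sigma> \<nabla>\<delta>u\<close> equals
  \<open>- \<sigma> \<nabla>\<delta>u\<close>. On an edge where \<open>\<nabla>u\<close> vanishes the current is just \<open>\<sigma> \<nabla>\<delta>u\<close>. In both cases it
  is \<open>s \<sigma> \<nabla>\<delta>u\<close> (lemma \<open>linearized_current\<close>): linearizing the power measurement flips the
  sign of the conductivity exactly on the support of \<open>\<nabla>u\<close>. The linearized interior equation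
  therefore says that \<open>\<delta>u\<close> solves a homogeneous Dirichlet problem for the conductivity \<open>s \<sigma>\<close>, and
  invertibility of the interior block of its Laplacian forces \<open>\<delta>u = 0\<close> (lemma
  \<open>dirichlet_unique\<close>). What remains of the power equation is
  \<open>(\<nabla>u)\<^sup>2 \<delta>\<sigma> = 0\<close>; since every edge carries a nonzero gradient of some \<open>u j\<close>, also \<open>\<delta>\<sigma> = 0\<close>.
\<close>

lemma (in oriented_graph) endpoints_in_nodes:
  assumes "e \<in> E"
  shows "fst (ends e) \<in> V" "snd (ends e) \<in> V"
  using edges[OF assms] ends[OF assms] by auto

text \<open>A function that vanishes on the boundary is, as far as edges can see, a combination of the
  interior basis vectors; this is what lets the interior block alone describe the Laplacian.\<close>

lemma (in oriented_graph) grad_expand_interior: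
  assumes I: "I \<subseteq> V" and zero: "\<And>i. i \<in> V - I \<Longrightarrow> v i = 0" and e: "e \<in> E"
  shows "grad ends v e = (\<Sum>k\<in>I. grad ends (indicator {k}) e * v k)"
proof -
  have "finite I"
    using I finite_nodes by (rule finite_subset)
  then have expand: "v i = (\<Sum>k\<in>I. indicator {k} i * v k)" if "i \<in> V" for i
    using zero[of i] that by (cases "i \<in> I") (auto simp: indicator_def if_distrib[of "\<lambda>x. x * _"] cong: if_cong)
  show ?thesis
    unfolding grad_def left_diff_distrib sum_subtractf
    using expand endpoints_in_nodes[OF e] by metis
qed

lemma (in oriented_graph) laplacian_eq_interior_block:
  assumes "I \<subseteq> V" and "\<And>i. i \<in> V - I \<Longrightarrow> v i = 0"
  shows "laplacian E ends \<tau> v i = (\<Sum>k\<in>I. laplacian_mat E ends \<tau> i k * v k)"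
proof -
  have "grad ends v e = (\<Sum>k\<in>I. grad ends (indicator {k}) e * v k)" if "e \<in> E" for e
    using assms that by (rule grad_expand_interior)
  then have "laplacian E ends \<tau> v i =
      (\<Sum>e\<in>E. \<Sum>k\<in>I. grad ends (indicator {i}) e * (\<tau> e * grad ends (indicator {k}) e) * v k)"
    unfolding laplacian_def gradT_def hadamard_def
    by (intro sum.cong refl) (simp add: sum_distrib_left mult.assoc)
  also have "\<dots> = (\<Sum>k\<in>I. laplacian_mat E ends \<tau> i k * v k)"
    unfolding laplacian_mat_def laplacian_def gradT_def hadamard_def
    by (subst sum.swap) (simp add: sum_distrib_right)
  finally show ?thesis .
qed

lemma invertible_on_kernel_trivial:
  assumes "finite X" and "invertible_on X M"
    and kernel: "\<And>i. i \<in> X \<Longrightarrow> (\<Sum>k\<in>X. M i k * v k) = 0" and i: "i \<in> X"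
  shows "v i = 0"
proof -
  obtain R where R: "\<And>i j. i \<in> X \<Longrightarrow> j \<in> X \<Longrightarrow> (\<Sum>k\<in>X. R i k * M k j) = (if i = j then 1 else 0)"
    using assms(2) unfolding invertible_on_def by blast
  have "v i = (\<Sum>j\<in>X. (\<Sum>k\<in>X. R i k * M k j) * v j)"
    using assms(1) i by (simp add: R if_distrib[of "\<lambda>x. x * _"] cong: if_cong)
  also have "\<dots> = (\<Sum>k\<in>X. R i k * (\<Sum>j\<in>X. M k j * v j))"
    unfolding sum_distrib_left sum_distrib_right by (subst sum.swap) (simp add: mult.assoc)
  also have "\<dots> = 0"
    by (simp add: kernel)
  finally show ?thesis .
qed

lemma (in oriented_graph) dirichlet_unique:
  assumes I: "I \<subseteq> V" and inv: "invertible_on I (laplacian_mat E ends \<tau>)"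
    and boundary: "\<And>i. i \<in> V - I \<Longrightarrow> v i = 0"
    and interior: "\<And>i. i \<in> I \<Longrightarrow> laplacian E ends \<tau> v i = 0"
    and "i \<in> V"
  shows "v i = 0"
proof (cases "i \<in> I")
  case True
  have "finite I"
    using I finite_nodes by (rule finite_subset)
  then show ?thesis
    using inv
  proof (rule invertible_on_kernel_trivial)
    show "(\<Sum>k\<in>I. laplacian_mat E ends \<tau> j k * v k) = 0" if "j \<in> I" for j
      using laplacian_eq_interior_block[of I v \<tau> j] I boundary interior[OF that] by simp
  qed (rule True)
qed (use boundary \<open>i \<in> V\<close> in blast)

text \<open>Read \<open>g\<close> and \<open>d\<close> as the values of \<open>\<nabla>u\<close> and \<open>\<nabla>\<delta>u\<close> at one edge, and \<open>c\<close> and \<open>dc\<close> as those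
  of \<open>\<sigma>\<close> and \<open>\<delta>\<sigma>\<close>. For \<open>g \<noteq> 0\<close> a factor \<open>g\<close> cancels from the power equation, leaving
  \<open>g dc = - 2 c d\<close>; the factor \<open>2\<close>, due to the square in the power, is what turns the sum
  into \<open>- c d\<close> instead of \<open>0\<close>.\<close>

lemma linearized_current:
  fixes g d c dc :: real
  assumes "\<bar>g\<bar>\<^sup>2 * dc + 2 * c * g * d = 0"
  shows "g * dc + c * d = (if g = 0 then c * d else - (c * d))"
proof -
  have "g * (g * dc + 2 * (c * d)) = 0"
    using assms by (simp add: power2_eq_square algebra_simps)
  then show ?thesis
    by auto
qed

theorem theorem2:
  fixes V B I :: "'v set" and E :: "'v set set" and ends :: "'v set \<Rightarrow> 'v \<times> 'v"
    and N :: nat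
    and \<sigma> \<delta>\<sigma> :: "'v set \<Rightarrow> real"
    and f u \<delta>u :: "nat \<Rightarrow> 'v \<Rightarrow> real"
    and s :: "nat \<Rightarrow> 'v set \<Rightarrow> real"
  assumes graph: "oriented_graph V E ends"
    and partition: "V = B \<union> I" "B \<inter> I = {}"
    and \<sigma>_pos: "\<forall>e\<in>E. \<sigma> e > 0"
    and N: "N \<ge> 1"
    and dirichlet_interior: "\<forall>j\<in>{1..N}. \<forall>i\<in>I. gradT E ends (\<sigma> \<odot> grad ends (u j)) i = 0"
    and dirichlet_boundary: "\<forall>j\<in>{1..N}. \<forall>i\<in>B. u j i = f j i"
    and s: "\<forall>j\<in>{1..N}. \<forall>e\<in>E. s j e = 1 - 2 * indicator (supp E (grad ends (u j))) e"
    and supports_cover: "(\<Union>j\<in>{1..N}. supp E (grad ends (u j))) = E"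
    and L_\<sigma>_invertible: "invertible_on I (laplacian_mat E ends \<sigma>)"
    and L_s\<sigma>_invertible: "\<forall>j\<in>{1..N}. invertible_on I (laplacian_mat E ends (s j \<odot> \<sigma>))"
    and power_linearized: "\<forall>j\<in>{1..N}. \<forall>e\<in>E.
          \<bar>grad ends (u j) e\<bar>\<^sup>2 * \<delta>\<sigma> e + 2 * \<sigma> e * grad ends (u j) e * grad ends (\<delta>u j) e = 0"
    and boundary_linearized: "\<forall>j\<in>{1..N}. \<forall>i\<in>B. \<delta>u j i = 0"
    and interior_linearized: "\<forall>j\<in>{1..N}. \<forall>i\<in>I.
          gradT E ends (grad ends (u j) \<odot> \<delta>\<sigma>) i + laplacian E ends \<sigma> (\<delta>u j) i = 0"
  shows "(\<forall>e\<in>E. \<delta>\<sigma> e = 0) \<and> (\<forall>j\<in>{1..N}. \<forall>i\<in>V. \<delta>u j i = 0)"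
proof -
  interpret oriented_graph V E ends
    by (rule graph)
  have \<delta>u_zero: "\<delta>u j i = 0" if j: "j \<in> {1..N}" and i: "i \<in> V" for j i
  proof (rule dirichlet_unique[of I "s j \<odot> \<sigma>"])
    show "I \<subseteq> V"
      using partition by blast
    show "invertible_on I (laplacian_mat E ends (s j \<odot> \<sigma>))"
      using L_s\<sigma>_invertible j by blast
    show "\<delta>u j k = 0" if "k \<in> V - I" for k
      using boundary_linearized j partition that by blast
    show "laplacian E ends (s j \<odot> \<sigma>) (\<delta>u j) k = 0" if k: "k \<in> I" for k
    proof -
      have "s j e * \<sigma> e * grad ends (\<delta>u j) e
          = grad ends (u j) e * \<delta>\<sigma> e + \<sigma> e * grad ends (\<delta>u j) e" if "e \<in> E" for e
        using linearized_current[of "grad ends (u j) e" "\<delta>\<sigma> e" "\<sigma> e" "grad ends (\<delta>u j) e"]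
          power_linearized s j that by (simp add: supp_def indicator_def)
      then have "laplacian E ends (s j \<odot> \<sigma>) (\<delta>u j) k
          = gradT E ends (grad ends (u j) \<odot> \<delta>\<sigma>) k + laplacian E ends \<sigma> (\<delta>u j) k"
        by (simp add: laplacian_def gradT_def hadamard_def flip: sum.distrib distrib_left)
      then show ?thesis
        using interior_linearized j k by simp
    qed
  qed (rule i)
  have "\<delta>\<sigma> e = 0" if e: "e \<in> E" for e
  proof -
    obtain j where j: "j \<in> {1..N}" and nz: "grad ends (u j) e \<noteq> 0"
      using e supports_cover unfolding supp_def by blast
    have "grad ends (\<delta>u j) e = 0"
      using \<delta>u_zero[OF j] endpoints_in_nodes[OF e] by (simp add: grad_def)
    then show ?thesis
      using power_linearized j e nz by fastforce
  qed
  then show ?thesis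
    using \<delta>u_zero by blast
qed

end
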